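(* Let $(X_k)_{k\ge 1}$ be a sequence of real-valued random variables on a probability space $(\Omega,\mathcal{K},P_X)$, and let $Y$ be a real-valued random variable such that, for some constant $M>0$, $$\frac1n\sum_{k=1}^n P(|X_k|>x)\le M\,P(|Y|>x)\quad\text{for all } x>0 \text{ and all integers } n\ge 1.$$ Let $1\le p<2$ and $1\le r\le p$. If $E|Y|^p<\infty$, then for every $\varepsilon>0$ $$\sum_{n=1}^\infty n^{p/r-2}\, P_X\left(\max_{1\le k\le n} k^{1/2}\, E_{\tilde\theta_k}|S_k(\tilde\theta_k)|>\varepsilon n^{1/r}\right)<\infty.$$
   Context: For each integer $k\ge 1$, $\tilde\theta_k=(\theta_{k,1},\dots,\theta_{k,k})$ is a random vector distributed uniformly on the unit sphere $\mathbb{S}^{k-1}\subset\mathbb{R}^k$ (i.e. according to the unique rotationally invariant probability measure $P_{\tilde\theta_k}$ on $\mathbb{S}^{k-1}$; for $k=1$ this is the uniform distribution on $\{-1,1\}$), independent of $(X_1,\dots,X_k)$, and $S_k(\tilde\theta_k)=\theta_{k,1}X_1+\cdots+\theta_{k,k}X_k$. The symbol $E_{\tilde\theta_k}$ denotes expectation with respect to $P_{\tilde\theta_k}$ only, so that $E_{\tilde\theta_k}|S_k(\tilde\theta_k)|$ is the random variable on $\Omega$ given by $\omega\mapsto\int_{\mathbb{S}^{k-1}}\left|\sum_{j=1}^k u_jX_j(\omega)\right| dP_{\tilde\theta_k}(u)$. No independence among the $X_k$ is assumed. *)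

theory Defs
  imports "HOL-Probability.Probability"
begin

text \<open>
  Since the dimension \<open>k\<close> varies inside the statement, \<open>\<real>\<^sup>k\<close> is modelled by the extensional functions
  on \<open>{1..k}\<close>, with the product Borel sigma-algebra, rather than by a type \<open>real ^ 'n\<close>.
\<close>

definition unit_sphere :: "nat \<Rightarrow> (nat \<Rightarrow> real) set" where
  "unit_sphere k = {u \<in> {1..k} \<rightarrow>\<^sub>E UNIV. (\<Sum>j=1..k. (u j)\<^sup>2) = 1}"

definition sphere_algebra :: "nat \<Rightarrow> (nat \<Rightarrow> real) measure" where
  "sphere_algebra k = restrict_space (\<Pi>\<^sub>M j\<in>{1..k}. borel) (unit_sphere k)"

definition orthogonal_mat :: "nat \<Rightarrow> (nat \<Rightarrow> nat \<Rightarrow> real) \<Rightarrow> bool" where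
  "orthogonal_mat k A \<longleftrightarrow>
     (\<forall>i\<in>{1..k}. \<forall>j\<in>{1..k}. (\<Sum>l=1..k. A l i * A l j) = (if i = j then 1 else 0))"

definition mat_apply :: "nat \<Rightarrow> (nat \<Rightarrow> nat \<Rightarrow> real) \<Rightarrow> (nat \<Rightarrow> real) \<Rightarrow> nat \<Rightarrow> real" where
  "mat_apply k A u = (\<lambda>i\<in>{1..k}. \<Sum>j=1..k. A i j * u j)"

text \<open>
  The uniform distribution on the sphere is the unique probability measure there that is invariant
  under rotations. Invariance is required under the full orthogonal group: for \<open>k = 1\<close> the special
  orthogonal group is trivial and would not single out the uniform distribution on \<open>{-1, 1}\<close>.
\<close>

definition uniform_on_sphere :: "nat \<Rightarrow> (nat \<Rightarrow> real) measure \<Rightarrow> bool" where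
  "uniform_on_sphere k P \<longleftrightarrow>
     prob_space P \<and> sets P = sets (sphere_algebra k) \<and>
     (\<forall>A. orthogonal_mat k A \<longrightarrow> distr P P (mat_apply k A) = P)"

end

theory Submission
  imports Defs
begin

text \<open>
  Rotation invariance makes the coordinates of a uniform point on the sphere orthogonal with second
  moment \<open>1 / k\<close>, so by Jensen \<open>k\<^sup>1\<^sup>/\<^sup>2 E|S\<^sub>k|\<close> is at most the Euclidean norm of \<open>(X\<^sub>1, \<dots>, X\<^sub>k)\<close>, which
  increases with \<open>k\<close>. With \<open>a = n\<^sup>1\<^sup>/\<^sup>r\<close>, if \<open>\<Sum>\<^sub>k\<^sub>\<le>\<^sub>n X\<^sub>k\<^sup>2 > \<epsilon>\<^sup>2 a\<^sup>2\<close> then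
  \<open>\<Sum>\<^sub>k\<^sub>\<le>\<^sub>n min X\<^sub>k\<^sup>2 a\<^sup>2 \<ge> min 1 \<epsilon>\<^sup>2 \<cdot> a\<^sup>2\<close>, so Markov's inequality and the tail domination bound the
  \<open>n\<close>-th probability by a constant times \<open>n E min (Y\<^sup>2 / a\<^sup>2) 1\<close>. Because \<open>p < 2\<close>, summing the weighted
  bounds inside the expectation over \<open>n\<close> gives at most a constant times \<open>|Y|\<^sup>p\<close>.
\<close>

section \<open>Power sums\<close>

text \<open>By the mean value theorem the difference is \<open>d * z powr (- 1 - d)\<close> for some
  \<open>z\<close> between \<open>x\<close> and \<open>x + 1\<close>. Since
  \<open>x \<ge> 1\<close>, also \<open>z \<le> 2 * x\<close>, which is where the factor
  \<open>2 powr (1 + d)\<close> comes from.\<close>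

lemma powr_diff_ge:
  fixes d x :: real
  assumes "d > 0" and "x \<ge> 1"
  shows "x powr (- 1 - d) \<le> 2 powr (1 + d) / d * (x powr (- d) - (x + 1) powr (- d))"
proof -
  have "\<exists>z>x. z < x + 1 \<and> (x + 1) powr (- d) - x powr (- d) = (x + 1 - x) * (- d * z powr (- 1 - d))"
    using assms by (intro MVT2) (auto intro!: derivative_eq_intros simp: powr_diff powr_minus field_simps)
  then obtain z where z: "z > x" "z < x + 1"
    and eq: "x powr (- d) - (x + 1) powr (- d) = d * z powr (- 1 - d)"
    by (auto simp: algebra_simps)
  have "(2 * x) powr (- 1 - d) \<le> z powr (- 1 - d)"
    using assms z by (intro powr_mono2') auto
  then have "d * (2 * x) powr (- 1 - d) \<le> x powr (- d) - (x + 1) powr (- d)"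
    using assms by (simp add: eq)
  then have "2 powr (1 + d) / d * (d * (2 * x) powr (- 1 - d))
      \<le> 2 powr (1 + d) / d * (x powr (- d) - (x + 1) powr (- d))"
    using assms by (intro mult_left_mono) auto
  moreover have "2 powr (1 + d) / d * (d * (2 * x) powr (- 1 - d)) = x powr (- 1 - d)"
    using assms by (simp add: powr_mult powr_add[symmetric] flip: mult.assoc)
  ultimately show ?thesis by simp
qed

text \<open>The differences from \<open>powr_diff_ge\<close> telescope, so the bound does not depend
  on \<open>N\<close>.\<close>

lemma sum_powr_tail_le:
  fixes d :: real
  assumes "d > 0" and "m \<ge> 1"
  shows "(\<Sum>n=m..N. real n powr (- 1 - d)) \<le> 2 powr (1 + d) / d * real m powr (- d)"
proof (cases "m \<le> N")
  case True
  have "(\<Sum>n=m..N. real n powr (- 1 - d))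
      \<le> (\<Sum>n=m..N. 2 powr (1 + d) / d * (real n powr (- d) - real (Suc n) powr (- d)))"
    using assms powr_diff_ge[OF assms(1)] by (intro sum_mono) (auto simp: add.commute[of _ 1])
  also have "\<dots> = 2 powr (1 + d) / d * (real m powr (- d) - real (Suc N) powr (- d))"
    using True sum_Suc_diff[of m N "\<lambda>n. - (real n powr (- d))"]
    by (subst sum_distrib_left[symmetric]) simp
  also have "\<dots> \<le> 2 powr (1 + d) / d * real m powr (- d)"
    using assms by (intro mult_left_mono) auto
  finally show ?thesis .
qed (use assms in auto)

text \<open>The sum is split at the integer part of \<open>q\<close>. Below it the minimum is
  bounded by 1: there are at most \<open>q\<close> terms, each at most \<open>q powr (s - 1)\<close>
  because \<open>s \<ge> 1\<close>. Above it the power is taken, and \<open>s < t\<close> makes the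
  remaining exponent of \<open>n\<close> less than -1, so the tail sums to order
  \<open>q powr s\<close> as well.\<close>

lemma sum_powr_min_le:
  fixes s t q :: real
  assumes "1 \<le> s" and "s < t" and "q \<ge> 0"
  shows "(\<Sum>n=1..N. real n powr (s - 1) * min ((q / real n) powr t) 1)
    \<le> (1 + 2 powr (1 + (t - s)) / (t - s)) * q powr s"
proof (cases "q = 0")
  case False
  then have q: "q > 0" using assms by simp
  have q_le: "q \<le> 1 + real_of_int \<lfloor>q\<rfloor>" by linarith
  define m where "m = nat \<lfloor>q\<rfloor>"
  define f where "f n = real n powr (s - 1) * min ((q / real n) powr t) 1" for n
  define K where "K = 2 powr (1 + (t - s)) / (t - s)"
  \<comment> \<open>Only an inequality, since \<open>m\<close> may exceed \<open>N\<close>; the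
    extra terms are nonnegative.\<close>
  have "(\<Sum>n=1..N. f n) \<le> (\<Sum>n\<in>{1..m} \<union> {m+1..N}. f n)"
    by (intro sum_mono2) (auto simp: f_def)
  also have "\<dots> = (\<Sum>n=1..m. f n) + (\<Sum>n=m+1..N. f n)"
    by (intro sum.union_disjoint) auto
  also have "(\<Sum>n=1..m. f n) \<le> (\<Sum>n=1..m. q powr (s - 1))"
  proof (intro sum_mono)
    fix n assume "n \<in> {1..m}"
    then have n: "real n \<le> q" "n \<ge> 1" using q by (auto simp: m_def le_nat_floor le_floor_iff nat_le_iff le_nat_iff)
    have "f n \<le> real n powr (s - 1) * 1" unfolding f_def by (intro mult_left_mono) auto
    also have "\<dots> \<le> q powr (s - 1)" using n assms by (simp add: powr_mono2)
    finally show "f n \<le> q powr (s - 1)" .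
  qed
  also have "\<dots> = real m * q powr (s - 1)" by simp
  also have "\<dots> \<le> q * q powr (s - 1)"
    using q by (intro mult_right_mono) (auto simp: m_def)
  also have "\<dots> = q powr s" using q by (simp add: powr_diff)
  also have "(\<Sum>n=m+1..N. f n) \<le> (\<Sum>n=m+1..N. q powr t * real n powr (- 1 - (t - s)))"
  proof (intro sum_mono)
    fix n assume n: "n \<in> {m+1..N}"
    have "f n \<le> real n powr (s - 1) * (q / real n) powr t"
      unfolding f_def by (intro mult_left_mono) auto
    also have "\<dots> = q powr t * real n powr (- 1 - (t - s))"
      using n q by (simp add: powr_divide powr_diff powr_add powr_minus field_simps)
    finally show "f n \<le> q powr t * real n powr (- 1 - (t - s))" .
  qed
  also have "\<dots> \<le> q powr t * (K * real (m + 1) powr (- (t - s)))"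
    unfolding sum_distrib_left[symmetric] K_def
    using assms by (intro mult_left_mono sum_powr_tail_le) auto
  \<comment> \<open>Here \<open>q \<le> m + 1\<close>, and the exponent is negative.\<close>
  also have "\<dots> \<le> q powr t * (K * q powr (- (t - s)))"
    using assms q by (intro mult_left_mono powr_mono2') (auto simp: K_def m_def q_le)
  also have "\<dots> = K * q powr s"
    using q by (simp add: powr_add[symmetric])
  finally show ?thesis by (simp add: f_def K_def algebra_simps)
qed auto

section \<open>Truncated expectations as integrals of tails\<close>

text \<open>Layer-cake argument: \<open>min (Z \<omega>) c\<close> is the length of the set of
  \<open>x\<close> in \<open>{0<..<c}\<close> below \<open>Z \<omega>\<close>, and Tonelli exchanges
  the two integrals. The interval is open at 0, so only tails at positive levels enter.\<close>

lemma nn_integral_min_eq_tail: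
  assumes "sigma_finite_measure N" and [measurable]: "Z \<in> borel_measurable N"
    and "\<And>\<omega>. Z \<omega> \<ge> 0" and "c \<ge> 0"
  shows "(\<integral>\<^sup>+\<omega>. ennreal (min (Z \<omega>) c) \<partial>N)
    = (\<integral>\<^sup>+x. indicator {0<..<c} x * emeasure N {\<omega> \<in> space N. Z \<omega> > x} \<partial>lborel)"
proof -
  interpret N: sigma_finite_measure N by fact
  interpret pair_sigma_finite lborel N ..
  have "(\<integral>\<^sup>+\<omega>. ennreal (min (Z \<omega>) c) \<partial>N)
      = (\<integral>\<^sup>+\<omega>. (\<integral>\<^sup>+x. indicator {0<..<c} x * indicator {..<Z \<omega>} x \<partial>lborel) \<partial>N)"
  proof (intro nn_integral_cong)
    fix \<omega>
    have "(\<integral>\<^sup>+x. indicator {0<..<c} x * indicator {..<Z \<omega>} x \<partial>lborel)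
        = (\<integral>\<^sup>+x. indicator {0<..<min (Z \<omega>) c} x \<partial>lborel)"
      by (intro nn_integral_cong) (auto simp: indicator_def)
    also have "\<dots> = ennreal (min (Z \<omega>) c)" using assms by simp
    finally show "ennreal (min (Z \<omega>) c)
        = (\<integral>\<^sup>+x. indicator {0<..<c} x * indicator {..<Z \<omega>} x \<partial>lborel)" by simp
  qed
  \<comment> \<open>The condition becomes membership in a set of pairs, which exhibits the joint
    measurability that \<open>Fubini'\<close> requires.\<close>
  also have "\<dots> = (\<integral>\<^sup>+\<omega>. (\<integral>\<^sup>+x. indicator {0<..<c} x * indicator {z. fst z < Z (snd z)} (x, \<omega>) \<partial>lborel) \<partial>N)"
    by (intro nn_integral_cong) (auto simp: indicator_def)
  also have "\<dots> = (\<integral>\<^sup>+x. (\<integral>\<^sup>+\<omega>. indicator {0<..<c} x * indicator {z. fst z < Z (snd z)} (x, \<omega>) \<partial>N) \<partial>lborel)"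
    by (rule Fubini') measurable
  also have "\<dots> = (\<integral>\<^sup>+x. indicator {0<..<c} x * emeasure N {\<omega> \<in> space N. Z \<omega> > x} \<partial>lborel)"
  proof (intro nn_integral_cong)
    fix x
    have "(\<integral>\<^sup>+\<omega>. indicator {z. fst z < Z (snd z)} (x, \<omega>) \<partial>N)
        = (\<integral>\<^sup>+\<omega>. indicator {\<omega> \<in> space N. Z \<omega> > x} \<omega> \<partial>N)"
      by (intro nn_integral_cong) (auto simp: indicator_def)
    then show "(\<integral>\<^sup>+\<omega>. indicator {0<..<c} x * indicator {z. fst z < Z (snd z)} (x, \<omega>) \<partial>N)
        = indicator {0<..<c} x * emeasure N {\<omega> \<in> space N. Z \<omega> > x}"
      by (simp add: nn_integral_cmult)
  qed
  finally show ?thesis .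
qed

section \<open>Moments of the uniform distribution on the sphere\<close>

lemma space_uniform_on_sphere:
  assumes "uniform_on_sphere k P"
  shows "space P = unit_sphere k"
proof -
  have "sets P = sets (sphere_algebra k)"
    using assms by (simp add: uniform_on_sphere_def)
  then have "space P = space (sphere_algebra k)" by (rule sets_eq_imp_space_eq)
  then show ?thesis
    by (auto simp: sphere_algebra_def space_restrict_space space_PiM unit_sphere_def)
qed

lemma measurable_uniform_on_sphere:
  assumes "uniform_on_sphere k P" and "f \<in> measurable (\<Pi>\<^sub>M j\<in>{1..k}. borel) N"
  shows "f \<in> measurable P N"
proof -
  have "sets P = sets (restrict_space (\<Pi>\<^sub>M j\<in>{1..k}. borel) (unit_sphere k))"
    using assms by (simp add: uniform_on_sphere_def sphere_algebra_def)
  then show ?thesis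
    using measurable_restrict_space1[OF assms(2), of "unit_sphere k"]
    by (simp cong: measurable_cong_sets)
qed

text \<open>The columns of \<open>A\<close> are orthonormal, so expanding the squares and summing
  over the row index first leaves only the diagonal terms.\<close>

lemma mat_apply_in_unit_sphere:
  assumes "orthogonal_mat k A" and "u \<in> unit_sphere k"
  shows "mat_apply k A u \<in> unit_sphere k"
proof -
  have "(\<Sum>l=1..k. (mat_apply k A u l)\<^sup>2) = (\<Sum>l=1..k. \<Sum>i=1..k. \<Sum>j=1..k. (u i * u j) * (A l i * A l j))"
    by (simp add: mat_apply_def power2_eq_square sum_product mult_ac)
  also have "\<dots> = (\<Sum>i=1..k. \<Sum>j=1..k. (u i * u j) * (\<Sum>l=1..k. A l i * A l j))"
    unfolding sum_distrib_left 
    by (rule trans[OF sum.swap], rule sum.cong[OF refl], rule sum.swap)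
  also have "\<dots> = (\<Sum>i=1..k. \<Sum>j=1..k. if i = j then u i * u j else 0)"
    using assms(1) unfolding orthogonal_mat_def by (intro sum.cong refl) auto
  also have "\<dots> = (\<Sum>i=1..k. (u i)\<^sup>2)"
    by (intro sum.cong refl) (simp add: power2_eq_square)
  finally show ?thesis
    using assms(2) by (auto simp: unit_sphere_def mat_apply_def)
qed

text \<open>Invariance as a change of variables. The work lies in showing that the map is measurable
  from \<open>P\<close> to \<open>P\<close>: its target carries the sigma-algebra restricted to the
  sphere, so preservation of the sphere enters.\<close>

lemma integral_mat_apply:
  fixes f :: "(nat \<Rightarrow> real) \<Rightarrow> real"
  assumes U: "uniform_on_sphere k P" and A: "orthogonal_mat k A"
    and f: "f \<in> borel_measurable P"
  shows "(\<integral>u. f (mat_apply k A u) \<partial>P) = (\<integral>u. f u \<partial>P)"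
proof -
  let ?B = "\<Pi>\<^sub>M j\<in>{1..k}. (borel :: real measure)"
  have "mat_apply k A \<in> measurable ?B ?B"
    unfolding mat_apply_def by measurable
  then have "mat_apply k A \<in> measurable P ?B"
    by (rule measurable_uniform_on_sphere[OF U])
  then have "mat_apply k A \<in> measurable P (restrict_space ?B (unit_sphere k))"
    using mat_apply_in_unit_sphere[OF A] space_uniform_on_sphere[OF U]
    by (intro measurable_restrict_space2) auto
  then have m: "mat_apply k A \<in> measurable P P"
    using U by (simp add: uniform_on_sphere_def sphere_algebra_def cong: measurable_cong_sets)
  have "distr P P (mat_apply k A) = P"
    using U A by (auto simp: uniform_on_sphere_def)
  then have "(\<integral>u. f u \<partial>P) = (\<integral>u. f u \<partial>distr P P (mat_apply k A))" by simp
  also have "\<dots> = (\<integral>u. f (mat_apply k A u) \<partial>P)"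
    by (rule integral_distr[OF m f])
  finally show ?thesis by simp
qed

lemma abs_unit_sphere_le_1:
  assumes "u \<in> unit_sphere k" and "j \<in> {1..k}"
  shows "\<bar>u j\<bar> \<le> 1"
proof -
  have "(u j)\<^sup>2 \<le> (\<Sum>i=1..k. (u i)\<^sup>2)"
    using assms(2) by (intro member_le_sum) auto
  also have "\<dots> = 1" using assms(1) by (simp add: unit_sphere_def)
  finally show ?thesis by (simp add: abs_square_le_1)
qed

lemma borel_measurable_uniform_on_sphere_component:
  assumes "uniform_on_sphere k P" and "j \<in> {1..k}"
  shows "(\<lambda>u. u j) \<in> borel_measurable P"
  using assms by (intro measurable_uniform_on_sphere[OF assms(1)]) measurable

lemma integrable_uniform_on_sphere_mult:
  assumes U: "uniform_on_sphere k P" and "i \<in> {1..k}" and "j \<in> {1..k}"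
  shows "integrable P (\<lambda>u. u i * u j)"
proof -
  interpret prob_space P using U by (simp add: uniform_on_sphere_def)
  show ?thesis
  proof (rule integrable_const_bound[where B = 1])
    show "AE u in P. norm (u i * u j) \<le> 1"
      using assms abs_unit_sphere_le_1[of _ k] space_uniform_on_sphere[OF U]
      by (intro AE_I2) (auto simp: abs_mult intro!: mult_le_one)
    show "(\<lambda>u. u i * u j) \<in> borel_measurable P"
      using assms borel_measurable_uniform_on_sphere_component[OF U] by measurable
  qed
qed

text \<open>Flipping the sign of coordinate \<open>i\<close> negates a mixed moment, which therefore
  vanishes. Swapping two coordinates shows that the \<open>k\<close> diagonal moments agree, and on
  the sphere they add up to 1.\<close>

lemma uniform_on_sphere_second_moment:
  assumes U: "uniform_on_sphere k P" and i: "i \<in> {1..k}" and j: "j \<in> {1..k}"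
  shows "(\<integral>u. u i * u j \<partial>P) = (if i = j then 1 / real k else 0)"
proof -
  interpret prob_space P using U by (simp add: uniform_on_sphere_def)
  have meas: "(\<lambda>u. u a * u b) \<in> borel_measurable P" if "a \<in> {1..k}" "b \<in> {1..k}" for a b
    using integrable_uniform_on_sphere_mult[OF U that] by auto
  show ?thesis
  proof (cases "i = j")
    case False
    \<comment> \<open>The reflection in coordinate \<open>i\<close>. Its determinant is -1, so
      invariance is used beyond the special orthogonal group.\<close>
    define A :: "nat \<Rightarrow> nat \<Rightarrow> real" where
      "A a b = (if a = b then if a = i then - 1 else 1 else 0)" for a b
    have "orthogonal_mat k A"
      unfolding orthogonal_mat_def A_def
      by (auto simp: if_distrib[of "\<lambda>x. x * _"] if_distrib[of "\<lambda>x. _ * x"] cong: if_cong)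
    moreover have "mat_apply k A u a = (if a = i then - u a else u a)" if "a \<in> {1..k}" for u a
      using that by (auto simp: mat_apply_def A_def if_distrib[of "\<lambda>x. x * _"] cong: if_cong)
    ultimately have "(\<integral>u. - (u i * u j) \<partial>P) = (\<integral>u. u i * u j \<partial>P)"
      using integral_mat_apply[OF U _ meas[OF i j], of A] i j False by simp
    then show ?thesis using False by simp
  next
    case True
    have eq: "(\<integral>u. u b * u b \<partial>P) = (\<integral>u. u i * u i \<partial>P)" if b: "b \<in> {1..k}" for b
    proof -
      define \<tau> where "\<tau> = Transposition.transpose i b"
      \<comment> \<open>The permutation matrix of the transposition; its orthogonality rests on
        \<open>\<tau>\<close> being an involution that preserves \<open>{1..k}\<close>.\<close>
      define A :: "nat \<Rightarrow> nat \<Rightarrow> real" where "A a c = (if c = \<tau> a then 1 else 0)" for a c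
      have \<tau>: "\<tau> a \<in> {1..k} \<longleftrightarrow> a \<in> {1..k}" for a
        using i b by (auto simp: \<tau>_def Transposition.transpose_def)
      have \<tau>2: "c = \<tau> a \<longleftrightarrow> a = \<tau> c" for a c
        by (auto simp: \<tau>_def)
      have "orthogonal_mat k A"
        unfolding orthogonal_mat_def
      proof (intro ballI)
        fix a c assume ac: "a \<in> {1..k}" "c \<in> {1..k}"
        have "(\<Sum>l=1..k. A l a * A l c) = (\<Sum>l=1..k. if l = \<tau> a then (if a = c then 1 else 0) else 0)"
          by (intro sum.cong refl) (auto simp: A_def \<tau>2[of a] \<tau>2[of c] \<tau>_def)
        also have "\<dots> = (if a = c then 1 else 0)"
          using \<tau>[of a] ac by auto
        finally show "(\<Sum>l=1..k. A l a * A l c) = (if a = c then 1 else 0)" .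
      qed
      moreover have "mat_apply k A u i = u b" for u
        using i b by (auto simp: mat_apply_def A_def \<tau>_def if_distrib[of "\<lambda>x. x * _"] cong: if_cong)
      ultimately show ?thesis
        using integral_mat_apply[OF U _ meas[OF i i], of A] by simp
    qed
    have "real k * (\<integral>u. u i * u i \<partial>P) = (\<Sum>b=1..k. \<integral>u. u b * u b \<partial>P)"
      using eq by simp
    also have "\<dots> = (\<integral>u. (\<Sum>b=1..k. u b * u b) \<partial>P)"
      using integrable_uniform_on_sphere_mult[OF U] by (intro Bochner_Integration.integral_sum[symmetric]) auto
    also have "\<dots> = (\<integral>u. 1 \<partial>P)"
      using space_uniform_on_sphere[OF U]
      by (intro Bochner_Integration.integral_cong) (auto simp: unit_sphere_def power2_eq_square)
    also have "\<dots> = 1" by (simp add: prob_space)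
    finally show ?thesis using i True by (auto simp: field_simps)
  qed
qed

text \<open>The vector \<open>x\<close> is fixed, later as \<open>X j \<omega>\<close> for a given
  \<open>\<omega>\<close>. By the second moments the linear form has mean square equal to the
  squared norm of \<open>x\<close> divided by \<open>k\<close>, and the factor
  \<open>real k powr (1/2)\<close> cancels this \<open>k\<close>.\<close>

lemma uniform_on_sphere_mean_abs_le:
  assumes U: "uniform_on_sphere k P"
  shows "real k powr (1/2) * (\<integral>u. \<bar>\<Sum>j=1..k. u j * x j\<bar> \<partial>P) \<le> sqrt (\<Sum>j=1..k. (x j)\<^sup>2)"
proof (cases "k = 0")
  case False
  interpret prob_space P using U by (simp add: uniform_on_sphere_def)
  define S where "S u = (\<Sum>j=1..k. u j * x j)" for u :: "nat \<Rightarrow> real"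
  have sq: "(S u)\<^sup>2 = (\<Sum>i=1..k. \<Sum>j=1..k. x i * x j * (u i * u j))" for u
    by (simp add: S_def power2_eq_square sum_product mult_ac)
  note int = integrable_uniform_on_sphere_mult[OF U]
  have intS2: "integrable P (\<lambda>u. (S u)\<^sup>2)"
    unfolding sq using int by (intro Bochner_Integration.integrable_sum integrable_mult_right) auto
  have "S \<in> borel_measurable P"
    unfolding S_def using borel_measurable_uniform_on_sphere_component[OF U] by measurable
  then have intS: "integrable P S"
    using intS2 by (rule square_integrable_imp_integrable)
  have "(\<integral>u. (S u)\<^sup>2 \<partial>P) = (\<Sum>i=1..k. \<Sum>j=1..k. x i * x j * (\<integral>u. u i * u j \<partial>P))"
    unfolding sq using int by (subst Bochner_Integration.integral_sum) (auto intro!: sum.cong)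
  also have "\<dots> = (\<Sum>i=1..k. \<Sum>j=1..k. if i = j then (x i)\<^sup>2 / real k else 0)"
    using uniform_on_sphere_second_moment[OF U]
    by (intro sum.cong refl) (auto simp: power2_eq_square)
  also have "\<dots> = (\<Sum>i=1..k. (x i)\<^sup>2) / real k"
    by (simp add: sum_divide_distrib)
  finally have "(\<integral>u. (S u)\<^sup>2 \<partial>P) = (\<Sum>i=1..k. (x i)\<^sup>2) / real k" .
  \<comment> \<open>Jensen's inequality, obtained from nonnegativity of the variance.\<close>
  moreover have "(\<integral>u. \<bar>S u\<bar> \<partial>P)\<^sup>2 \<le> (\<integral>u. \<bar>S u\<bar>\<^sup>2 \<partial>P)"
    using intS intS2 variance_eq[of "\<lambda>u. \<bar>S u\<bar>"] variance_positive[of "\<lambda>u. \<bar>S u\<bar>"] by simp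
  ultimately have "real k * (\<integral>u. \<bar>S u\<bar> \<partial>P)\<^sup>2 \<le> (\<Sum>i=1..k. (x i)\<^sup>2)"
    using False by (simp add: mult.commute pos_le_divide_eq)
  then have "(sqrt (real k) * (\<integral>u. \<bar>S u\<bar> \<partial>P))\<^sup>2 \<le> (\<Sum>i=1..k. (x i)\<^sup>2)"
    by (simp add: power_mult_distrib)
  then show ?thesis
    by (simp add: S_def powr_half_sqrt real_le_rsqrt)
qed auto

section \<open>From tail domination to truncated expectations\<close>

text \<open>After the layer-cake formula both sides are integrals over \<open>x\<close> in
  \<open>{0<..<c}\<close> of tails, and \<open>tail\<close> compares the integrands level by level.
  Truncation at \<open>c\<close> makes everything integrable, which permits the passage between real
  and extended integrals.\<close>

lemma sum_expectation_min_le: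
  fixes Z :: "'i \<Rightarrow> 'a \<Rightarrow> real" and W :: "'b \<Rightarrow> real"
  assumes "prob_space N" and "prob_space N'" and "finite I" and "C \<ge> 0" and "c \<ge> 0"
    and Z[measurable]: "\<And>i. i \<in> I \<Longrightarrow> Z i \<in> borel_measurable N" and "\<And>i \<omega>. Z i \<omega> \<ge> 0"
    and W[measurable]: "W \<in> borel_measurable N'" and "\<And>\<omega>. W \<omega> \<ge> 0"
    and tail: "\<And>x. x > 0 \<Longrightarrow> (\<Sum>i\<in>I. measure N {\<omega> \<in> space N. Z i \<omega> > x})
      \<le> C * measure N' {\<omega> \<in> space N'. W \<omega> > x}"
  shows "(\<Sum>i\<in>I. \<integral>\<omega>. min (Z i \<omega>) c \<partial>N) \<le> C * (\<integral>\<omega>. min (W \<omega>) c \<partial>N')"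
proof -
  interpret N: prob_space N by fact
  interpret N': prob_space N' by fact
  have nnN: "ennreal (\<integral>\<omega>. min (Z i \<omega>) c \<partial>N) = (\<integral>\<^sup>+\<omega>. ennreal (min (Z i \<omega>) c) \<partial>N)"
    if i: "i \<in> I" for i
    using assms i by (intro nn_integral_eq_integral[symmetric] N.integrable_const_bound[where B = c]) auto
  have nnN': "ennreal (\<integral>\<omega>. min (W \<omega>) c \<partial>N') = (\<integral>\<^sup>+\<omega>. ennreal (min (W \<omega>) c) \<partial>N')"
    using assms by (intro nn_integral_eq_integral[symmetric] N'.integrable_const_bound[where B = c]) auto
  have "ennreal (\<Sum>i\<in>I. \<integral>\<omega>. min (Z i \<omega>) c \<partial>N) = (\<Sum>i\<in>I. ennreal (\<integral>\<omega>. min (Z i \<omega>) c \<partial>N))"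
    using assms by (intro sum_ennreal[symmetric] integral_nonneg_AE) auto
  also have "\<dots> = (\<Sum>i\<in>I. \<integral>\<^sup>+x. indicator {0<..<c} x * emeasure N {\<omega> \<in> space N. Z i \<omega> > x} \<partial>lborel)"
    using assms N.sigma_finite_measure_axioms
    by (intro sum.cong refl) (simp add: nnN nn_integral_min_eq_tail)
  also have "\<dots> = (\<integral>\<^sup>+x. (\<Sum>i\<in>I. indicator {0<..<c} x * emeasure N {\<omega> \<in> space N. Z i \<omega> > x}) \<partial>lborel)"
    using assms by (intro nn_integral_sum[symmetric]) auto
  also have "\<dots> \<le> (\<integral>\<^sup>+x. ennreal C * (indicator {0<..<c} x * emeasure N' {\<omega> \<in> space N'. W \<omega> > x}) \<partial>lborel)"
  proof (intro nn_integral_mono)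
    fix x :: real
    have "(\<Sum>i\<in>I. emeasure N {\<omega> \<in> space N. Z i \<omega> > x}) \<le> ennreal C * emeasure N' {\<omega> \<in> space N'. W \<omega> > x}"
      if "x > 0"
      using tail[OF that] assms(4)
      by (simp add: N.emeasure_eq_measure N'.emeasure_eq_measure sum_ennreal ennreal_mult[symmetric] ennreal_leI)
    then show "(\<Sum>i\<in>I. indicator {0<..<c} x * emeasure N {\<omega> \<in> space N. Z i \<omega> > x})
        \<le> ennreal C * (indicator {0<..<c} x * emeasure N' {\<omega> \<in> space N'. W \<omega> > x})"
      by (auto simp: indicator_def)
  qed
  also have "\<dots> = ennreal C * (\<integral>\<^sup>+x. indicator {0<..<c} x * emeasure N' {\<omega> \<in> space N'. W \<omega> > x} \<partial>lborel)"
    by (intro nn_integral_cmult) measurable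
  also have "\<dots> = ennreal C * (\<integral>\<^sup>+\<omega>. ennreal (min (W \<omega>) c) \<partial>N')"
    using assms N'.sigma_finite_measure_axioms by (simp add: nn_integral_min_eq_tail)
  also have "\<dots> = ennreal (C * (\<integral>\<omega>. min (W \<omega>) c \<partial>N'))"
    using assms by (subst nnN'[symmetric]) (simp add: ennreal_mult integral_nonneg_AE)
  finally show ?thesis
    using assms by (subst (asm) ennreal_le_iff) (auto intro!: mult_nonneg_nonneg integral_nonneg_AE)
qed

section \<open>Bounding each probability and summing over \<open>n\<close>\<close>

theorem theorem3p2:
  fixes P\<^sub>X :: "'a measure" and X :: "nat \<Rightarrow> 'a \<Rightarrow> real"
    and P\<^sub>Y :: "'b measure" and Y :: "'b \<Rightarrow> real"
    and P\<^sub>\<theta> :: "nat \<Rightarrow> (nat \<Rightarrow> real) measure"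
    and M p r \<epsilon> :: real
  assumes "prob_space P\<^sub>X" and "\<And>k. k \<ge> 1 \<Longrightarrow> X k \<in> borel_measurable P\<^sub>X"
    and "prob_space P\<^sub>Y" and "Y \<in> borel_measurable P\<^sub>Y"
    and "\<And>k. k \<ge> 1 \<Longrightarrow> uniform_on_sphere k (P\<^sub>\<theta> k)"
    and "M > 0"
    and "\<And>x n. x > 0 \<Longrightarrow> n \<ge> 1 \<Longrightarrow>
           1 / real n * (\<Sum>k=1..n. measure P\<^sub>X {\<omega> \<in> space P\<^sub>X. \<bar>X k \<omega>\<bar> > x})
             \<le> M * measure P\<^sub>Y {\<omega> \<in> space P\<^sub>Y. \<bar>Y \<omega>\<bar> > x}"
    and "1 \<le> p" and "p < 2" and "1 \<le> r" and "r \<le> p"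
    and "integrable P\<^sub>Y (\<lambda>\<omega>. \<bar>Y \<omega>\<bar> powr p)"
    and "\<epsilon> > 0"
  shows "(\<lambda>n::nat. real n powr (p / r - 2) *
            measure P\<^sub>X {\<omega> \<in> space P\<^sub>X.
              Max ((\<lambda>k. real k powr (1/2) * (\<integral>u. \<bar>\<Sum>j=1..k. u j * X j \<omega>\<bar> \<partial>P\<^sub>\<theta> k)) ` {1..n})
                > \<epsilon> * real n powr (1 / r)})
          summable_on {1..}"
proof -
  interpret PX: prob_space P\<^sub>X by fact
  interpret PY: prob_space P\<^sub>Y by fact
  note Xm[measurable] = assms(2) and Ym[measurable] = assms(4)
  define R where "R k \<omega> = real k powr (1/2) * (\<integral>u. \<bar>\<Sum>j=1..k. u j * X j \<omega>\<bar> \<partial>P\<^sub>\<theta> k)" for k \<omega>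
  define E where "E n = {\<omega> \<in> space P\<^sub>X. Max ((\<lambda>k. R k \<omega>) ` {1..n}) > \<epsilon> * real n powr (1 / r)}" for n
  define c where "c = min 1 (\<epsilon>\<^sup>2)"
  have c: "c > 0" "c \<le> 1" "c \<le> \<epsilon>\<^sup>2" using assms(13) by (auto simp: c_def)
  define a where "a n = real n powr (1 / r)" for n :: nat
  \<comment> \<open>The inner power equals the square of \<open>Y \<omega> / a n\<close>; this form
    fits \<open>sum_powr_min_le\<close> with \<open>q = \<bar>Y \<omega>\<bar> powr r\<close>. The
    exponent is \<open>p / r - 1\<close> rather than \<open>p / r - 2\<close> because the domination
    of averages contributes a factor \<open>n\<close>.\<close>
  define G where "G n \<omega> = real n powr (p / r - 1) * min ((\<bar>Y \<omega>\<bar> powr r / real n) powr (2 / r)) 1" for n :: nat and \<omega>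
  have intG: "integrable P\<^sub>Y (G n)" for n
    unfolding G_def
    by (rule PY.integrable_const_bound[where B = "real n powr (p / r - 1)"])
       (auto simp: abs_mult intro!: mult_left_le)
  have main: "real n powr (p / r - 2) * measure P\<^sub>X (E n) \<le> M / c * (\<integral>\<omega>. G n \<omega> \<partial>P\<^sub>Y)"
    if n: "n \<ge> 1" for n
  proof -
    have a: "a n > 0" using n by (simp add: a_def)
    define T where "T \<omega> = (\<Sum>k=1..n. min ((X k \<omega>)\<^sup>2) ((a n)\<^sup>2))" for \<omega>
    have T[measurable]: "T \<in> borel_measurable P\<^sub>X"
      unfolding T_def by (intro borel_measurable_sum borel_measurable_min borel_measurable_power borel_measurable_const Xm) auto
    have intX: "integrable P\<^sub>X (\<lambda>\<omega>. min ((X k \<omega>)\<^sup>2) ((a n)\<^sup>2))" if "k \<in> {1..n}" for k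
      using that Xm[of k] by (intro PX.integrable_const_bound[where B = "(a n)\<^sup>2"]) auto
    have "E n \<subseteq> {\<omega> \<in> space P\<^sub>X. T \<omega> \<ge> c * (a n)\<^sup>2}"
    proof
      fix \<omega> assume \<omega>: "\<omega> \<in> E n"
      then obtain k where k: "k \<in> {1..n}" "\<epsilon> * a n < R k \<omega>"
        using n by (auto simp: E_def a_def Max_gr_iff)
      have "R k \<omega> \<le> sqrt (\<Sum>j=1..k. (X j \<omega>)\<^sup>2)"
        using k unfolding R_def by (intro uniform_on_sphere_mean_abs_le assms(5)) auto
      \<comment> \<open>This bound is free of \<open>k\<close>, so the maximum is disposed of
        without a maximal inequality.\<close>
      also have "\<dots> \<le> sqrt (\<Sum>j=1..n. (X j \<omega>)\<^sup>2)"
        using k by (intro real_sqrt_le_mono sum_mono2) auto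
      finally have "sqrt ((\<epsilon> * a n)\<^sup>2) < sqrt (\<Sum>j=1..n. (X j \<omega>)\<^sup>2)"
        using k assms(13) a by simp
      then have gt: "(\<epsilon> * a n)\<^sup>2 < (\<Sum>j=1..n. (X j \<omega>)\<^sup>2)"
        by (simp only: real_sqrt_less_iff)
      have "c * (a n)\<^sup>2 \<le> T \<omega>"
      \<comment> \<open>Either truncation changes nothing, or a single truncated term already
        contributes the square of \<open>a n\<close>; \<open>c\<close> is the smaller of the two
        resulting constants.\<close>
      proof (cases "\<forall>j\<in>{1..n}. (X j \<omega>)\<^sup>2 \<le> (a n)\<^sup>2")
        case True
        have "c * (a n)\<^sup>2 \<le> \<epsilon>\<^sup>2 * (a n)\<^sup>2" using c by (intro mult_right_mono) auto
        also have "\<dots> \<le> (\<Sum>j=1..n. (X j \<omega>)\<^sup>2)" using gt by (simp add: power_mult_distrib)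
        also have "\<dots> = T \<omega>" using True unfolding T_def by (intro sum.cong) auto
        finally show ?thesis .
      next
        case False
        then obtain j where j: "j \<in> {1..n}" "(X j \<omega>)\<^sup>2 > (a n)\<^sup>2" by force
        have "c * (a n)\<^sup>2 \<le> 1 * (a n)\<^sup>2" using c by (intro mult_right_mono) auto
        also have "\<dots> = min ((X j \<omega>)\<^sup>2) ((a n)\<^sup>2)" using j by simp
        also have "\<dots> \<le> T \<omega>" unfolding T_def using j by (intro member_le_sum) auto
        finally show ?thesis .
      qed
      then show "\<omega> \<in> {\<omega> \<in> space P\<^sub>X. T \<omega> \<ge> c * (a n)\<^sup>2}" using \<omega> by (simp add: E_def)
    qed
    \<comment> \<open>Monotonicity asks for measurability of the larger set, which comes from that
      of \<open>T\<close>.\<close>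
    then have "measure P\<^sub>X (E n) \<le> measure P\<^sub>X {\<omega> \<in> space P\<^sub>X. T \<omega> \<ge> c * (a n)\<^sup>2}"
      by (intro PX.finite_measure_mono) measurable
    also have "\<dots> \<le> (\<integral>\<omega>. T \<omega> \<partial>P\<^sub>X) / (c * (a n)\<^sup>2)"
      using intX a c unfolding T_def
      by (intro integral_Markov_inequality_measure[where A = "{}"]) (auto intro!: sum_nonneg)
    also have "(\<integral>\<omega>. T \<omega> \<partial>P\<^sub>X) = (\<Sum>k=1..n. \<integral>\<omega>. min ((X k \<omega>)\<^sup>2) ((a n)\<^sup>2) \<partial>P\<^sub>X)"
      unfolding T_def using intX by (intro Bochner_Integration.integral_sum)
    also have "\<dots> \<le> M * real n * (\<integral>\<omega>. min ((Y \<omega>)\<^sup>2) ((a n)\<^sup>2) \<partial>P\<^sub>Y)"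
    proof (rule sum_expectation_min_le)
      fix x :: real assume x: "x > 0"
      \<comment> \<open>The comparison concerns squares, so the tail hypothesis is used at level
        \<open>sqrt x\<close>.\<close>
      have sq: "x < y\<^sup>2 \<longleftrightarrow> sqrt x < \<bar>y\<bar>" for y
        using real_sqrt_less_iff[of x "y\<^sup>2"] by simp
      show "(\<Sum>i=1..n. measure P\<^sub>X {\<omega> \<in> space P\<^sub>X. x < (X i \<omega>)\<^sup>2})
          \<le> M * real n * measure P\<^sub>Y {\<omega> \<in> space P\<^sub>Y. x < (Y \<omega>)\<^sup>2}"
        using assms(7)[of "sqrt x" n] x n unfolding sq by (simp add: field_simps)
    qed (use assms in auto)
    finally have "measure P\<^sub>X (E n) \<le> M * real n * (\<integral>\<omega>. min ((Y \<omega>)\<^sup>2) ((a n)\<^sup>2) \<partial>P\<^sub>Y) / (c * (a n)\<^sup>2)"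
      using a c by (simp add: divide_right_mono)
    then have "real n powr (p / r - 2) * measure P\<^sub>X (E n)
        \<le> real n powr (p / r - 2) * (M * real n * (\<integral>\<omega>. min ((Y \<omega>)\<^sup>2) ((a n)\<^sup>2) \<partial>P\<^sub>Y) / (c * (a n)\<^sup>2))"
      by (intro mult_left_mono) auto
    also have "\<dots> = M / c * (real n powr (p / r - 1) / (a n)\<^sup>2 * (\<integral>\<omega>. min ((Y \<omega>)\<^sup>2) ((a n)\<^sup>2) \<partial>P\<^sub>Y))"
      using n by (simp add: powr_diff field_simps power2_eq_square)
    also have "\<dots> = M / c * (\<integral>\<omega>. real n powr (p / r - 1) / (a n)\<^sup>2 * min ((Y \<omega>)\<^sup>2) ((a n)\<^sup>2) \<partial>P\<^sub>Y)"
      by (subst integral_mult_right_zero) simp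
    also have "(\<lambda>\<omega>. real n powr (p / r - 1) / (a n)\<^sup>2 * min ((Y \<omega>)\<^sup>2) ((a n)\<^sup>2)) = G n"
    proof
      fix \<omega>
      have "(\<bar>Y \<omega>\<bar> powr r / real n) powr (2 / r) = (Y \<omega>)\<^sup>2 / (a n)\<^sup>2"
        using n assms(10) by (simp add: powr_divide powr_powr a_def powr_power)
      then have "min ((Y \<omega>)\<^sup>2) ((a n)\<^sup>2) / (a n)\<^sup>2 = min ((\<bar>Y \<omega>\<bar> powr r / real n) powr (2 / r)) 1"
        using a by (simp add: min_divide_distrib_right)
      then show "real n powr (p / r - 1) / (a n)\<^sup>2 * min ((Y \<omega>)\<^sup>2) ((a n)\<^sup>2) = G n \<omega>"
        by (simp add: G_def flip: times_divide_eq_right)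
    qed
    finally show ?thesis .
  qed
  define s where "s = p / r"
  define t where "t = 2 / r"
  \<comment> \<open>\<open>r \<le> p\<close> gives the first inequality and \<open>p < 2\<close> the
    second.\<close>
  have st: "1 \<le> s" "s < t" using assms by (auto simp: s_def t_def divide_strict_right_mono)
  define K where "K = 1 + 2 powr (1 + (t - s)) / (t - s)"
  define B where "B = M / c * (K * (\<integral>\<omega>. \<bar>Y \<omega>\<bar> powr p \<partial>P\<^sub>Y))"
  have "(\<lambda>n. real n powr (p / r - 2) * measure P\<^sub>X (E n)) summable_on {1..}"
  proof (rule nonneg_bdd_above_summable_on)
    have "(\<Sum>n\<in>F. real n powr (p / r - 2) * measure P\<^sub>X (E n)) \<le> B"
      if F: "finite F" "F \<subseteq> {1..}" for F
    proof -
      \<comment> \<open>Inserting 0 covers the case of empty \<open>F\<close>.\<close>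
      define N where "N = Max (insert 0 F)"
      have "F \<subseteq> {1..N}" using F by (auto simp: N_def)
      then have "(\<Sum>n\<in>F. real n powr (p / r - 2) * measure P\<^sub>X (E n))
          \<le> (\<Sum>n=1..N. real n powr (p / r - 2) * measure P\<^sub>X (E n))"
        by (intro sum_mono2) auto
      also have "\<dots> \<le> (\<Sum>n=1..N. M / c * (\<integral>\<omega>. G n \<omega> \<partial>P\<^sub>Y))"
        by (intro sum_mono main) auto
      also have "\<dots> = M / c * (\<integral>\<omega>. (\<Sum>n=1..N. G n \<omega>) \<partial>P\<^sub>Y)"
        using intG by (simp add: sum_distrib_left)
      also have "\<dots> \<le> M / c * (\<integral>\<omega>. K * \<bar>Y \<omega>\<bar> powr p \<partial>P\<^sub>Y)"
      proof (intro mult_left_mono integral_mono)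
        fix \<omega>
        have "(\<Sum>n=1..N. G n \<omega>) \<le> K * (\<bar>Y \<omega>\<bar> powr r) powr s"
          unfolding G_def K_def s_def[symmetric] t_def[symmetric] using st by (intro sum_powr_min_le) auto
        also have "(\<bar>Y \<omega>\<bar> powr r) powr s = \<bar>Y \<omega>\<bar> powr p"
          using assms(10) by (simp add: powr_powr s_def)
        finally show "(\<Sum>n=1..N. G n \<omega>) \<le> K * \<bar>Y \<omega>\<bar> powr p" .
      qed (use intG assms c in auto)
      finally show ?thesis by (simp add: B_def)
    qed
    then show "bdd_above (sum (\<lambda>n. real n powr (p / r - 2) * measure P\<^sub>X (E n)) ` {F. F \<subseteq> {1..} \<and> finite F})"
      by (intro bdd_aboveI2) auto
  qed auto
  then show ?thesis unfolding E_def R_def .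
qed

end
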